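(* Let $m\ge 1$ be an integer, and let $B>0$, $l_k>0$, $\epsilon\in(0,1)$, $\alpha_0>0$, $\sigma_k^2>0$, $p_k[n]>0$, $H>0$, $\mathbf{q}[n],\mathbf{c}_k[n]\in\mathbb{R}^2$ be given (deterministic), and let $d_k[n]=\sqrt{\|\mathbf{q}[n]-\mathbf{c}_k[n]\|^2+H^2}$. Let the small-scale fading $\hat h_k[n]$ be Nakagami-$m$ distributed with unit mean power, let $h_k[n]=\sqrt{\alpha_0/d_k^2[n]}\,\hat h_k[n]$, let $\Gamma_k[n]=|h_k[n]|^2p_k[n]/\sigma_k^2$ be the instantaneous SNR, and let $R_k[n]=R_k(\Gamma_k[n])$ be the finite-blocklength rate, where for $\Gamma\ge 0$ $$R_k(\Gamma)=B\left(\log_2(1+\Gamma)-\sqrt{\frac{1-(1+\Gamma)^{-2}}{l_k}}\,Q^{-1}(\epsilon)\right).$$ Let $R_k^{\mathrm{th}}$ be a target rate, and let $\Gamma_k^{\mathrm{th}}>0$ be the minimum SNR required to support the target rate $R_k^{\mathrm{th}}$. Then the outage probability $P_k[n]=\Pr\left(R_k[n]<R_k^{\mathrm{th}}\right)$ is given by $$P_k[n]=1-\exp\left(-m\,g_k[n]\right)\sum_{i=0}^{m-1}\frac{1}{i!}\left(m\,g_k[n]\right)^i,\qquad g_k[n]=\frac{d_k^2[n]\,\Gamma_k^{\mathrm{th}}\,\sigma_k^2}{\alpha_0\,p_k[n]}.$$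
   Context: $Q(x)=\frac{1}{\sqrt{2\pi}}\int_x^\infty e^{-t^2/2}\,dt$ is the Gaussian Q-function and $Q^{-1}$ is its inverse on $(0,1)$. A (possibly complex) random variable $\hat h$ is Nakagami-$m$ distributed with unit mean power if its amplitude $|\hat h|$ has the Nakagami distribution with shape parameter $m$ and $\mathbb{E}[|\hat h|^2]=1$; equivalently, $|\hat h|^2$ has the Gamma distribution with shape $m$ and rate $m$, i.e. density $\frac{m^m}{\Gamma(m)}x^{m-1}e^{-mx}$ on $x>0$ (here $\Gamma(\cdot)$ is the Gamma function). "The minimum SNR required to support the target rate $R_k^{\mathrm{th}}$" means the smallest $\Gamma\ge 0$ such that $R_k(\Gamma)\ge R_k^{\mathrm{th}}$; it is assumed to be strictly positive. Interpretation of the parameters: $\mathbf{q}[n]$ is the horizontal position of a drone at altitude $H$ in time slot $n$, $\mathbf{c}_k[n]$ the position of the $k$-th ground vehicle, $\alpha_0$ the channel gain at distance 1, $p_k[n]$ the transmit power, $\sigma_k^2$ the noise power, $B$ the bandwidth, $l_k$ the blocklength, $\epsilon$ the block error rate. *)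

theory Defs
  imports "HOL-Probability.Probability"
begin

definition gaussian_Q :: "real \<Rightarrow> real" where
  "gaussian_Q x = 1 / sqrt (2 * pi) * (LBINT t:{x..}. exp (- t\<^sup>2 / 2))"

(* gaussian_Q is a strictly decreasing bijection from the reals onto (0,1), so this is
   the inverse of gaussian_Q on (0,1); its values elsewhere are irrelevant. *)
definition gaussian_Q_inv :: "real \<Rightarrow> real" where
  "gaussian_Q_inv = the_inv gaussian_Q"

(* Density of the Nakagami distribution with shape m and spread \<Omega>. *)
definition nakagami_density :: "real \<Rightarrow> real \<Rightarrow> real \<Rightarrow> real" where
  "nakagami_density m \<Omega> x =
     (if x > 0
      then 2 * m powr m / (Gamma m * \<Omega> powr m) * x powr (2 * m - 1) * exp (- m * x\<^sup>2 / \<Omega>)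
      else 0)"

(* Only the amplitude is constrained, the phase is arbitrary.  The spread is not fixed to 1
   beforehand: it is determined by the mean power. *)
definition nakagami_unit_power :: "'a measure \<Rightarrow> ('a \<Rightarrow> complex) \<Rightarrow> real \<Rightarrow> bool" where
  "nakagami_unit_power M h m \<longleftrightarrow>
     h \<in> borel_measurable M \<and>
     (\<exists>\<Omega>>0. distributed M lborel (\<lambda>\<omega>. norm (h \<omega>)) (nakagami_density m \<Omega>)) \<and>
     integrable M (\<lambda>\<omega>. (norm (h \<omega>))\<^sup>2) \<and>
     (\<integral>\<omega>. (norm (h \<omega>))\<^sup>2 \<partial>M) = 1"

definition link_distance :: "real \<Rightarrow> real ^ 2 \<Rightarrow> real ^ 2 \<Rightarrow> real" where
  "link_distance H q c = sqrt ((norm (q - c))\<^sup>2 + H\<^sup>2)"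

definition channel_coeff :: "real \<Rightarrow> real \<Rightarrow> complex \<Rightarrow> complex" where
  "channel_coeff \<alpha>\<^sub>0 d hhat = complex_of_real (sqrt (\<alpha>\<^sub>0 / d\<^sup>2)) * hhat"

definition inst_snr :: "real \<Rightarrow> real \<Rightarrow> complex \<Rightarrow> real" where
  "inst_snr p \<sigma> h = (norm h)\<^sup>2 * p / \<sigma>\<^sup>2"

definition fbl_rate :: "real \<Rightarrow> real \<Rightarrow> real \<Rightarrow> real \<Rightarrow> real" where
  "fbl_rate B l \<epsilon> snr =
     B * (log 2 (1 + snr) - sqrt ((1 - (1 + snr) powi (-2)) / l) * gaussian_Q_inv \<epsilon>)"

definition is_min_snr :: "(real \<Rightarrow> real) \<Rightarrow> real \<Rightarrow> real \<Rightarrow> bool" where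
  "is_min_snr R Rth snr \<longleftrightarrow>
     snr \<ge> 0 \<and> R snr \<ge> Rth \<and> (\<forall>snr'\<ge>0. R snr' \<ge> Rth \<longrightarrow> snr \<le> snr')"

end

theory Submission
  imports Defs
begin

text \<open>
  Two facts carry the proof. In the variable \<open>t = log 2 (1 + \<Gamma>)\<close> the rate is \<open>t\<close> minus a multiple of
  the square root of a concave function vanishing at \<open>0\<close>. It need not be monotone, since
  \<open>Q\<^sup>-\<^sup>1(\<epsilon>)\<close> may be positive, but it vanishes at \<open>0\<close> and is increasing wherever it is positive. A positive
  minimum SNR forces a positive target rate, so outage means exactly \<open>\<Gamma> < \<Gamma>\<^sup>t\<^sup>h\<close>. The probability of
  that event follows because the substitution \<open>y = m x\<^sup>2 / \<Omega>\<close> turns the Nakagami density into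
  \<open>y\<^sup>m\<^sup>-\<^sup>1 e\<^sup>-\<^sup>y / (m - 1)!\<close>, whose tail is elementary; the same substitution shows
  that the mean power is \<open>\<Omega>\<close>, hence \<open>\<Omega> = 1\<close>.
\<close>

section \<open>Survival function of the Erlang distribution\<close>

text \<open>Survival function of the Gamma distribution with integer shape n + 1 and rate 1; the
  index is the shape minus one.\<close>

definition erlang_tail :: "nat \<Rightarrow> real \<Rightarrow> real" where
  "erlang_tail n y = exp (- y) * (\<Sum>i\<le>n. y ^ i / fact i)"

lemma erlang_tail_0 [simp]: "erlang_tail n 0 = 1"
  by (induction n) (auto simp: erlang_tail_def)

text \<open>The derivative telescopes: each new summand contributes the difference of two
  consecutive Erlang densities, so only the last density survives.\<close>

lemma DERIV_erlang_tail:
  "(erlang_tail n has_real_derivative - (y ^ n * exp (- y) / fact n)) (at y)"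
proof (induction n)
  case 0
  show ?case
    unfolding erlang_tail_def by (auto intro!: derivative_eq_intros)
next
  case (Suc n)
  have split: "erlang_tail (Suc n) = (\<lambda>y. erlang_tail n y + exp (- y) * y ^ Suc n / fact (Suc n))"
    by (auto simp: erlang_tail_def fun_eq_iff algebra_simps)
  have pow: "((\<lambda>y::real. y ^ Suc n / fact (Suc n)) has_real_derivative y ^ n / fact n) (at y)"
    by (rule derivative_eq_intros refl)+ (simp_all add: divide_simps)
  have ex: "((\<lambda>y::real. exp (- y)) has_real_derivative - exp (- y)) (at y)"
    by (auto intro!: derivative_eq_intros)
  show ?case
    unfolding split
    by (rule DERIV_cong[OF DERIV_add[OF Suc DERIV_mult[OF ex pow, simplified times_divide_eq_right]]])
       simp
qed

lemma tendsto_erlang_tail: "(erlang_tail n \<longlongrightarrow> 0) at_top"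
proof -
  have "((\<lambda>y::real. \<Sum>i\<le>n. y ^ i / exp y / fact i) \<longlongrightarrow> 0) at_top"
    by (intro tendsto_null_sum tendsto_divide_zero tendsto_power_div_exp_0)
  then show ?thesis
    by (simp add: erlang_tail_def[abs_def] exp_minus sum_distrib_left field_simps)
qed

text \<open>By the chain rule the integrand is the derivative of
  \<open>- erlang_tail n (r * x\<^sup>2)\<close>, which tends to 0. The substitution thus takes
  place inside the antiderivative.\<close>

lemma nn_integral_erlang_tail_square:
  fixes r a :: real
  assumes "r > 0" "a \<ge> 0"
  shows "(\<integral>\<^sup>+x. ennreal ((r * x\<^sup>2) ^ n * exp (- (r * x\<^sup>2)) / fact n * (2 * r * x)) * indicator {a..} x \<partial>lborel)
       = ennreal (erlang_tail n (r * a\<^sup>2))"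
proof -
  have "(\<integral>\<^sup>+x. ennreal ((r * x\<^sup>2) ^ n * exp (- (r * x\<^sup>2)) / fact n * (2 * r * x)) * indicator {a..} x \<partial>lborel)
      = 0 - (- erlang_tail n (r * a\<^sup>2))"
  proof (rule nn_integral_FTC_atLeast)
    fix x :: real
    assume "a \<le> x"
    have "((\<lambda>x. r * x\<^sup>2) has_real_derivative 2 * r * x) (at x)"
      by (auto intro!: derivative_eq_intros)
    from DERIV_minus[OF DERIV_chain2[OF DERIV_erlang_tail this]]
    show "((\<lambda>x. - erlang_tail n (r * x\<^sup>2)) has_real_derivative
        (r * x\<^sup>2) ^ n * exp (- (r * x\<^sup>2)) / fact n * (2 * r * x)) (at x)"
      by (rule DERIV_cong) simp
    show "0 \<le> (r * x\<^sup>2) ^ n * exp (- (r * x\<^sup>2)) / fact n * (2 * r * x)"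
      using assms \<open>a \<le> x\<close> by simp
  next
    have "filterlim (\<lambda>x. r * x\<^sup>2) at_top at_top"
      using assms by (intro filterlim_tendsto_pos_mult_at_top[OF tendsto_const]
          filterlim_pow_at_top filterlim_ident) auto
    from tendsto_minus[OF filterlim_compose[OF tendsto_erlang_tail this]]
    show "((\<lambda>x. - erlang_tail n (r * x\<^sup>2)) \<longlongrightarrow> 0) at_top"
      by simp
  qed measurable
  then show ?thesis by simp
qed

section \<open>Mean power and tail of the Nakagami amplitude\<close>

text \<open>The last factor is dy/dx, so this is the Erlang density pulled back along y. It also
  makes the right-hand side vanish at x = 0, where the density is 0 by definition.\<close>

lemma nakagami_density_eq:
  fixes n :: nat and x \<Omega> :: real
  assumes "x \<ge> 0" "\<Omega> > 0"
  defines "y \<equiv> real (Suc n) / \<Omega> * x\<^sup>2"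
  shows "nakagami_density (real (Suc n)) \<Omega> x = y ^ n * exp (- y) / fact n * (2 * (real (Suc n) / \<Omega>) * x)"
proof (cases "x = 0")
  case False
  with assms have "x > 0" by simp
  have pow: "x powr (2 * real (Suc n) - 1) = x ^ (2 * n + 1)"
    using \<open>x > 0\<close> by (subst powr_realpow[symmetric]) auto
  have m: "real (Suc n) powr real (Suc n) = real (Suc n) ^ Suc n" "\<Omega> powr real (Suc n) = \<Omega> ^ Suc n"
    using assms by (auto simp only: powr_realpow of_nat_0_less_iff)
  have G: "Gamma (real (Suc n)) = fact n"
    using Gamma_fact[of n, where 'a = real] by (simp add: add.commute)
  have "nakagami_density (real (Suc n)) \<Omega> x =
      2 * real (Suc n) ^ Suc n / (fact n * \<Omega> ^ Suc n) * x ^ (2 * n + 1) * exp (- y)"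
    using \<open>x > 0\<close> unfolding nakagami_density_def pow m G y_def by (simp del: of_nat_Suc)
  also have "\<dots> = y ^ n * exp (- y) / fact n * (2 * (real (Suc n) / \<Omega>) * x)"
    unfolding y_def using \<open>\<Omega> > 0\<close>
    by (simp add: power_mult_distrib power_divide power_mult[symmetric] mult_ac del: of_nat_Suc)
  finally show ?thesis .
qed (simp add: nakagami_density_def)

text \<open>Since x^2 = \<Omega> y / (n + 1), multiplying by x^2 turns y^n / n! into \<Omega>
  y^(n+1) / (n+1)!: the Erlang density with shape raised by one, of total mass 1, times
  \<Omega>.\<close>

lemma nakagami_second_moment:
  assumes "\<Omega> > 0"
  shows "(\<integral>\<^sup>+x. ennreal (nakagami_density (real (Suc n)) \<Omega> x) * ennreal (x\<^sup>2) \<partial>lborel) = ennreal \<Omega>"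
proof -
  define r where "r = real (Suc n) / \<Omega>"
  have r: "r > 0" "\<Omega> = real (Suc n) / r"
    using assms by (auto simp: r_def)
  have dens: "nakagami_density (real (Suc n)) \<Omega> x * x\<^sup>2 =
      \<Omega> * ((r * x\<^sup>2) ^ Suc n * exp (- (r * x\<^sup>2)) / fact (Suc n) * (2 * r * x))" if "x \<ge> 0" for x
    unfolding nakagami_density_eq[OF that \<open>\<Omega> > 0\<close>] r_def[symmetric]
    using r(1) by (subst r(2)) (simp add: divide_simps del: of_nat_Suc)
  have "(\<integral>\<^sup>+x. ennreal (nakagami_density (real (Suc n)) \<Omega> x) * ennreal (x\<^sup>2) \<partial>lborel) =
      (\<integral>\<^sup>+x. ennreal \<Omega> * (ennreal ((r * x\<^sup>2) ^ Suc n * exp (- (r * x\<^sup>2)) / fact (Suc n) * (2 * r * x))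
        * indicator {0..} x) \<partial>lborel)"
  proof (rule nn_integral_cong)
    fix x :: real
    show "ennreal (nakagami_density (real (Suc n)) \<Omega> x) * ennreal (x\<^sup>2) =
      ennreal \<Omega> * (ennreal ((r * x\<^sup>2) ^ Suc n * exp (- (r * x\<^sup>2)) / fact (Suc n) * (2 * r * x))
        * indicator {0..} x)"
    proof (cases "x \<ge> 0")
      case True
      have "ennreal (nakagami_density (real (Suc n)) \<Omega> x) * ennreal (x\<^sup>2) =
          ennreal (nakagami_density (real (Suc n)) \<Omega> x * x\<^sup>2)"
        by (simp add: ennreal_mult'')
      then show ?thesis
        unfolding dens[OF True] ennreal_mult'[OF less_imp_le[OF \<open>\<Omega> > 0\<close>]] using True by simp
    qed (simp add: nakagami_density_def)
  qed
  also have "\<dots> = ennreal \<Omega> * ennreal (erlang_tail (Suc n) (r * 0\<^sup>2))"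
    by (subst nn_integral_cmult) (simp_all only: nn_integral_erlang_tail_square[OF r(1) order_refl], measurable)
  finally show ?thesis by simp
qed

lemma (in prob_space) nakagami_unit_power_tail:
  assumes "nakagami_unit_power M h (real (Suc n))" "a \<ge> 0"
  shows "\<P>(\<omega> in M. a \<le> norm (h \<omega>)) = erlang_tail n (real (Suc n) * a\<^sup>2)"
proof -
  from assms obtain \<Omega> where \<Omega>: "\<Omega> > 0"
    and D: "distributed M lborel (\<lambda>\<omega>. norm (h \<omega>)) (nakagami_density (real (Suc n)) \<Omega>)"
    and int: "integrable M (\<lambda>\<omega>. (norm (h \<omega>))\<^sup>2)" "(\<integral>\<omega>. (norm (h \<omega>))\<^sup>2 \<partial>M) = 1"
    unfolding nakagami_unit_power_def by blast
  \<comment> \<open>The spread is only known to exist; computing the mean power in two ways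
    identifies it.\<close>
  have "ennreal \<Omega> = (\<integral>\<^sup>+\<omega>. ennreal ((norm (h \<omega>))\<^sup>2) \<partial>M)"
    unfolding nakagami_second_moment[OF \<Omega>, of n, symmetric]
    by (rule distributed_nn_integral[OF D]) measurable
  also have "\<dots> = ennreal 1"
    using int by (subst nn_integral_eq_integral) auto
  finally have "\<Omega> = 1"
    using \<Omega> by simp
  have "emeasure M ((\<lambda>\<omega>. norm (h \<omega>)) -` {a..} \<inter> space M) =
      (\<integral>\<^sup>+x. ennreal (nakagami_density (real (Suc n)) \<Omega> x) * indicator {a..} x \<partial>lborel)"
    by (rule distributed_emeasure[OF D]) simp
  also have "\<dots> = (\<integral>\<^sup>+x. ennreal ((real (Suc n) * x\<^sup>2) ^ n * exp (- (real (Suc n) * x\<^sup>2)) / fact n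
      * (2 * real (Suc n) * x)) * indicator {a..} x \<partial>lborel)"
    using \<open>a \<ge> 0\<close> nakagami_density_eq[of _ 1 n] \<open>\<Omega> = 1\<close>
    by (intro nn_integral_cong) (auto simp: indicator_def simp del: of_nat_Suc)
  also have "\<dots> = ennreal (erlang_tail n (real (Suc n) * a\<^sup>2))"
    using \<open>a \<ge> 0\<close> by (intro nn_integral_erlang_tail_square) auto
  finally have "emeasure M ((\<lambda>\<omega>. norm (h \<omega>)) -` {a..} \<inter> space M)
      = ennreal (erlang_tail n (real (Suc n) * a\<^sup>2))" .
  moreover have "(\<lambda>\<omega>. norm (h \<omega>)) -` {a..} \<inter> space M = {\<omega> \<in> space M. a \<le> norm (h \<omega>)}"
    by auto
  moreover have "erlang_tail n (real (Suc n) * a\<^sup>2) \<ge> 0"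
    unfolding erlang_tail_def by (intro mult_nonneg_nonneg sum_nonneg) auto
  ultimately show ?thesis
    by (simp add: measure_def)
qed

section \<open>Monotonicity of the rate where it is positive\<close>

text \<open>A concave function vanishing at 0 has a nonincreasing ratio to its argument.\<close>

lemma one_minus_exp_concave:
  fixes s t b :: real
  assumes "0 < s" "s \<le> t"
  shows "1 - exp (- (b * t)) \<le> t / s * (1 - exp (- (b * s)))"
proof -
  \<comment> \<open>The weight s / t makes -(b s) a convex combination of 0 and -(b t).\<close>
  have "exp ((1 - s / t) *\<^sub>R 0 + (s / t) *\<^sub>R (- (b * t))) \<le> (1 - s / t) * exp 0 + s / t * exp (- (b * t))"
    using assms by (intro convex_onD[OF exp_convex]) auto
  then have "exp (- (b * s)) \<le> 1 - s / t * (1 - exp (- (b * t)))"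
    using assms by (simp add: algebra_simps)
  then show ?thesis
    using assms by (simp add: field_simps)
qed

text \<open>For z < 0 both terms of the rate increase. For z \<ge> 0, scaling s up to t multiplies
  the penalty by at most t / s, so the rate grows at least by that factor, and positivity makes this
  an increase.\<close>

lemma fbl_rate_mono_if_pos:
  assumes "B > 0" "l > 0" "0 < x" "x \<le> y" "fbl_rate B l \<epsilon> x > 0"
  shows "fbl_rate B l \<epsilon> x \<le> fbl_rate B l \<epsilon> y"
proof -
  define z where "z = gaussian_Q_inv \<epsilon>"
  define s t where "s = log 2 (1 + x)" and "t = log 2 (1 + y)"
  define S where "S u = sqrt ((1 - exp (- (2 * ln 2 * u))) / l)" for u :: real
  have s: "0 < s" "s \<le> t"
    using assms by (auto simp: s_def t_def)
  have powi: "(1 + v) powi (- 2) = exp (- (2 * ln 2 * log 2 (1 + v)))" if "v > 0" for v :: real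
  proof -
    have "exp (- (2 * ln 2 * log 2 (1 + v))) = exp (- (2 * ln (1 + v)))"
      by (simp add: log_def)
    also have "\<dots> = inverse ((exp (ln (1 + v)))\<^sup>2)"
      by (simp add: exp_minus exp_double)
    finally show ?thesis
      using that by (simp add: power_int_minus)
  qed
  have rate: "fbl_rate B l \<epsilon> x = B * (s - S s * z)" "fbl_rate B l \<epsilon> y = B * (t - S t * z)"
    using assms powi by (simp_all add: fbl_rate_def S_def s_def t_def z_def)
  have "s - S s * z \<le> t - S t * z"
  proof (cases "z \<ge> 0")
    case False
    have "S s \<le> S t"
      unfolding S_def using s assms
      by (intro real_sqrt_le_mono divide_right_mono) auto
    with False have "S t * z \<le> S s * z"
      by (intro mult_right_mono_neg) auto
    with s show ?thesis by simp
  next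
    case True
    have "1 - exp (- (2 * ln 2 * t)) \<le> t / s * (1 - exp (- (2 * ln 2 * s)))"
      using s by (rule one_minus_exp_concave)
    \<comment> \<open>Weakening t / s \<ge> 1 to its square lets the root return exactly the factor
      t / s.\<close>
    also have "\<dots> \<le> (t / s)\<^sup>2 * (1 - exp (- (2 * ln 2 * s)))"
      using s by (intro mult_right_mono self_le_power) auto
    finally have "S t \<le> sqrt ((t / s)\<^sup>2 * ((1 - exp (- (2 * ln 2 * s))) / l))"
      unfolding S_def using assms by (simp add: divide_right_mono)
    also have "\<dots> = t / s * S s"
      unfolding S_def using s by (subst real_sqrt_mult) simp
    finally have "S t * z \<le> t / s * S s * z"
      using True by (rule mult_right_mono)
    then have "t / s * (s - S s * z) \<le> t - S t * z"
      using s by (simp add: algebra_simps)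
    moreover have "1 * (s - S s * z) \<le> t / s * (s - S s * z)"
      using s assms by (intro mult_right_mono) (auto simp: rate zero_less_mult_iff)
    ultimately show ?thesis by simp
  qed
  with \<open>B > 0\<close> show ?thesis by (simp add: rate)
qed

lemma fbl_rate_less_iff_less_min_snr:
  assumes "B > 0" "l > 0" "is_min_snr (fbl_rate B l \<epsilon>) Rth snr" "snr > 0" "x \<ge> 0"
  shows "fbl_rate B l \<epsilon> x < Rth \<longleftrightarrow> x < snr"
proof
  assume "x < snr"
  with assms show "fbl_rate B l \<epsilon> x < Rth"
    unfolding is_min_snr_def by force
next
  assume less: "fbl_rate B l \<epsilon> x < Rth"
  \<comment> \<open>If \<open>Rth\<close> were at most 0, the SNR 0 would already support it,
    contradicting the minimality of \<open>snr\<close> > 0.\<close>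
  have "fbl_rate B l \<epsilon> 0 = 0"
    by (simp add: fbl_rate_def)
  with assms have "Rth > 0"
    unfolding is_min_snr_def by force
  with assms have "snr \<le> x \<Longrightarrow> Rth \<le> fbl_rate B l \<epsilon> x"
    using fbl_rate_mono_if_pos[of B l snr x \<epsilon>] unfolding is_min_snr_def by linarith
  with less show "x < snr" by linarith
qed

section \<open>Outage probability of the faded link\<close>

theorem proposition1:
  fixes M :: "'a measure"
    and m k n :: nat
    and B \<epsilon> \<alpha>\<^sub>0 H :: real
    and l \<sigma> Rth \<Gamma>th :: "nat \<Rightarrow> real"
    and p :: "nat \<Rightarrow> nat \<Rightarrow> real"
    and q :: "nat \<Rightarrow> real ^ 2"
    and c :: "nat \<Rightarrow> nat \<Rightarrow> real ^ 2"
    and hhat :: "nat \<Rightarrow> nat \<Rightarrow> 'a \<Rightarrow> complex"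
  defines "d \<equiv> link_distance H (q n) (c k n)"
  defines "h \<equiv> (\<lambda>\<omega>. channel_coeff \<alpha>\<^sub>0 d (hhat k n \<omega>))"
  defines "\<Gamma> \<equiv> (\<lambda>\<omega>. inst_snr (p k n) (\<sigma> k) (h \<omega>))"
  defines "R \<equiv> fbl_rate B (l k) \<epsilon>"
  defines "g \<equiv> d\<^sup>2 * \<Gamma>th k * (\<sigma> k)\<^sup>2 / (\<alpha>\<^sub>0 * p k n)"
  assumes "prob_space M"
    and "m \<ge> 1" and "B > 0" and "l k > 0" and "0 < \<epsilon>" and "\<epsilon> < 1"
    and "\<alpha>\<^sub>0 > 0" and "(\<sigma> k)\<^sup>2 > 0" and "p k n > 0" and "H > 0"
    and "nakagami_unit_power M (hhat k n) (real m)"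
    and "is_min_snr R (Rth k) (\<Gamma>th k)" and "\<Gamma>th k > 0"
  shows "\<P>(\<omega> in M. R (\<Gamma> \<omega>) < Rth k)
       = 1 - exp (- real m * g) * (\<Sum>i<m. 1 / fact i * (real m * g) ^ i)"
proof -
  interpret prob_space M by fact
  \<comment> \<open>The sum over i < m then becomes the sum over i \<le> j in
    \<open>erlang_tail j\<close>.\<close>
  obtain j where j: "m = Suc j"
    using \<open>m \<ge> 1\<close> by (cases m) auto
  have nak: "nakagami_unit_power M (hhat k n) (real (Suc j))"
    using \<open>nakagami_unit_power M (hhat k n) (real m)\<close> by (simp add: j)
  then have [measurable]: "hhat k n \<in> borel_measurable M"
    by (simp add: nakagami_unit_power_def)
  have d: "d > 0"
    unfolding d_def link_distance_def using \<open>H > 0\<close> by (simp add: add_nonneg_pos)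
  have g: "g > 0"
    unfolding g_def using assms(6-) d by simp
  have \<Gamma>: "\<Gamma> \<omega> = \<alpha>\<^sub>0 / d\<^sup>2 * (norm (hhat k n \<omega>))\<^sup>2 * p k n / (\<sigma> k)\<^sup>2" for \<omega>
    unfolding \<Gamma>_def h_def inst_snr_def channel_coeff_def
    using \<open>\<alpha>\<^sub>0 > 0\<close> by (simp add: norm_mult power_mult_distrib)
  have "\<Gamma> \<omega> \<ge> 0" for \<omega>
    unfolding \<Gamma> using assms(6-) by simp
  then have "R (\<Gamma> \<omega>) < Rth k \<longleftrightarrow> \<Gamma> \<omega> < \<Gamma>th k" for \<omega>
    using assms(6-) unfolding R_def by (intro fbl_rate_less_iff_less_min_snr) auto
  \<comment> \<open>Dividing by the mean SNR, \<alpha>\<open>\<^sub>0\<close> p / (d^2 \<sigma>^2),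
    turns the SNR threshold into the fading power threshold \<open>g\<close>.\<close>
  also have "\<Gamma> \<omega> < \<Gamma>th k \<longleftrightarrow> (norm (hhat k n \<omega>))\<^sup>2 < g" for \<omega>
    unfolding \<Gamma> g_def using assms(6-) d by (simp add: field_simps)
  \<comment> \<open>Outage is written as the complement of a closed amplitude tail, evaluated below
    at \<open>sqrt g\<close>, whose square gives back \<open>g\<close>.\<close>
  also have "(norm (hhat k n \<omega>))\<^sup>2 < g \<longleftrightarrow> \<not> sqrt g \<le> norm (hhat k n \<omega>)" for \<omega>
    using g by (metis not_le real_sqrt_less_iff real_sqrt_abs abs_norm_cancel)
  finally have "\<P>(\<omega> in M. R (\<Gamma> \<omega>) < Rth k) = \<P>(\<omega> in M. \<not> sqrt g \<le> norm (hhat k n \<omega>))"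
    by simp
  also have "\<dots> = 1 - \<P>(\<omega> in M. sqrt g \<le> norm (hhat k n \<omega>))"
    by (rule prob_neg) measurable
  also have "\<P>(\<omega> in M. sqrt g \<le> norm (hhat k n \<omega>)) = erlang_tail j (real m * g)"
    using nakagami_unit_power_tail[OF nak, of "sqrt g"] g by (simp add: j)
  finally show ?thesis
    by (simp add: erlang_tail_def j lessThan_Suc_atMost del: of_nat_Suc)
qed

end
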